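(* Let the circulation be nonzero ($\lambda\neq0$) and let the system move on the level set of integrals $p_x=-\chi$, $p_y=-\zeta$, $K=0$. Put $$r=\sqrt{(\chi+\lambda y)^2+(\lambda x-\zeta)^2},\qquad \sigma=\sqrt{\chi^2+\zeta^2}.$$ A partial stabilization of the body at the point $(x,y)$ during an infinite interval of time (as defined in the context), performed by rotating the rotor and by means of reciprocating motions of the internal mass along a straight line fixed in the body (i.e. with constant polar angle of $(\xi,\eta)$ about $O_1$), is possible only inside and on the circle $r=\sigma$ in the $(x,y)$-plane (i.e. only at points with $r\le\sigma$).
   Context: Model: a two-dimensional hydrodynamically asymmetric rigid body (mass $M$, central moment of inertia $I$) moves in an unbounded ideal incompressible fluid with constant nonzero circulation $\Gamma$ around the body. It carries a point mass $m$ at $(\xi(t),\eta(t))$ in the body frame, confined to the (bounded) body, and a homogeneous circular rotor of mass $m_r$ and central moment of inertia $I_r$, rotating relative to the body with angular velocity $\Omega(t)$; $\xi(t),\eta(t),\Omega(t)$ are the controls. The body frame has its origin $O_1$ at the center of mass of the body--rotor system; $(\xi_b,\eta_b)$, $(\xi_r,\eta_r)$ are the body-frame centers of mass of body and rotor, $M\xi_b+m_r\xi_r=0$, $M\eta_b+m_r\eta_r=0$. $\lambda_1\neq\lambda_2$ are the added masses, $\lambda_6$ the added moment of inertia; $\lambda=\rho_f\Gamma$, $\zeta=\rho_f\Gamma\mu$, $\chi=\rho_f\Gamma\nu$, where $\rho_f>0$ is the fluid density and $\mu,\nu$ are constants of hydrodynamical asymmetry. $(x,y)$ are the coordinates of $O_1$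 in the fixed frame, $\alpha$ the rotation angle of the body, $(v_1,v_2)$ the velocity of $O_1$ in body axes, $\omega=\dot\alpha$, with $$\dot x=v_1\cos\alpha-v_2\sin\alpha,\quad \dot y=v_1\sin\alpha+v_2\cos\alpha .$$ Put $a_i=M+m+m_r+\lambda_i$ $(i=1,2)$, $f=-m\eta$, $g=m\xi$, $b=M(\xi_b^2+\eta_b^2)+I+m(\xi^2+\eta^2)+m_r(\xi_r^2+\eta_r^2)+I_r+\lambda_6$. The motion preserves $$p_x=(a_1v_1+f\omega+m\dot\xi-\chi)\cos\alpha-(a_2v_2+g\omega+m\dot\eta-\zeta)\sin\alpha+\lambda y,$$ $$p_y=(a_1v_1+f\omega+m\dot\xi-\chi)\sin\alpha+(a_2v_2+g\omega+m\dot\eta-\zeta)\cos\alpha-\lambda x,$$ $$K=fv_1+gv_2+b\omega+m(\xi\dot\eta-\dot\xi\eta)+I_r\Omega+\tfrac{\lambda}{2}(x^2+y^2)+xp_y-yp_x,$$ and, on a fixed level of these integrals, they determine $(v_1,v_2,\omega)$ and hence the evolution of $(x,y,\alpha)$ for given controls. The system starts from $x=y=\alpha=0$ with the body, the rotor and the mass at rest, so the motion is on the level set $p_x=-\chi$, $p_y=-\zeta$, $K=0$. Suppose that at time $T$ the body has arrived at the point $(x,y)$ with orientation $\alpha$. A partial stabilization at $(x,y)$ during an infinite interval of time is a choice of limited (bounded) controls for $t\ge T$ (the mass stays within the bounded body and its velocity and $\Omega$ are bounded) such that $\dot x=\dot y=0$ for all $t\ge T$, while the body rotates about the fixed point, $\dot\alpha\ne0$.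 With $\dot x=\dot y=0$ the integrals give $$m\dot\xi-m\eta\dot\alpha=\bar x\cos\alpha+\bar y\sin\alpha+\chi,\quad m\dot\eta+m\xi\dot\alpha=-\bar x\sin\alpha+\bar y\cos\alpha+\zeta,$$ $$-m\eta\dot\xi+m\xi\dot\eta+b\dot\alpha=\frac{\chi^2+\zeta^2-\bar x^2-\bar y^2}{2\lambda}-I_r\Omega,$$ where $\bar x=-\chi-\lambda y$, $\bar y=-\zeta+\lambda x$ are constants. The motion of the mass is $\xi=\rho(t)\cos\gamma$, $\eta=\rho(t)\sin\gamma$ with $\gamma$ constant and $\rho(t)$ the distance of the mass from $O_1$; its initial position on the line at time $T$ may be chosen. *)

theory Defs
  imports "HOL-Analysis.Analysis"
begin

text \<open>
  Constant data of a planar rigid body carrying a rotor and a point mass in an ideal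
  fluid with circulation. Coordinates are taken in the body frame, whose origin is the centre
  of mass of the body-rotor system.
  \<^item> \<open>mass_b\<close>, \<open>inertia_b\<close>, \<open>(xi_b, eta_b)\<close>: mass, central moment of inertia and centre of mass
    of the body (\<open>M\<close>, \<open>I\<close>);
  \<^item> \<open>mass_r\<close>, \<open>inertia_r\<close>, \<open>(xi_r, eta_r)\<close>: the same for the rotor;
  \<^item> \<open>mass_p\<close>: the point mass \<open>m\<close>;
  \<^item> \<open>add1\<close>, \<open>add2\<close>, \<open>add6\<close>: added masses and added moment of inertia;
  \<^item> \<open>rho_f\<close>, \<open>circ\<close>, \<open>mu\<close>, \<open>nu\<close>: fluid density, circulation, constants of hydrodynamical
    asymmetry;
  \<^item> \<open>region\<close>: the part of the plane occupied by the body.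
\<close>

record body_system =
  mass_b :: real
  inertia_b :: real
  xi_b :: real
  eta_b :: real
  mass_r :: real
  inertia_r :: real
  xi_r :: real
  eta_r :: real
  mass_p :: real
  add1 :: real
  add2 :: real
  add6 :: real
  rho_f :: real
  circ :: real
  mu :: real
  nu :: real
  region :: "(real \<times> real) set"

definition valid_system :: "body_system \<Rightarrow> bool" where
  "valid_system P \<longleftrightarrow>
     mass_b P > 0 \<and> inertia_b P > 0 \<and> mass_r P > 0 \<and> inertia_r P > 0 \<and> mass_p P > 0 \<and>
     rho_f P > 0 \<and> add1 P \<noteq> add2 P \<and>
     mass_b P * xi_b P + mass_r P * xi_r P = 0 \<and>
     mass_b P * eta_b P + mass_r P * eta_r P = 0 \<and>
     bounded (region P)"

definition lam :: "body_system \<Rightarrow> real" where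
  "lam P = rho_f P * circ P"

definition zet :: "body_system \<Rightarrow> real" where
  "zet P = rho_f P * circ P * mu P"

definition chi :: "body_system \<Rightarrow> real" where
  "chi P = rho_f P * circ P * nu P"

text \<open>
  \<open>(xi, eta)\<close> is the position of the point mass in the body frame, \<open>(dxi, deta)\<close> its velocity,
  \<open>rotor\<close> the angular velocity of the rotor relative to the body. That \<open>dxi\<close> and \<open>deta\<close> are
  the derivatives of \<open>xi\<close> and \<open>eta\<close> is required in \<open>bounded_controls\<close>.
\<close>

record controls =
  xi :: "real \<Rightarrow> real"
  eta :: "real \<Rightarrow> real"
  dxi :: "real \<Rightarrow> real"
  deta :: "real \<Rightarrow> real"
  rotor :: "real \<Rightarrow> real"

text \<open>
  \<open>(posx, posy)\<close> is the position of the origin of the body frame in the fixed frame, \<open>angle\<close> the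
  rotation angle, \<open>(vel1, vel2)\<close> the velocity of the origin in body axes, \<open>omg\<close> the angular
  velocity of the body.
\<close>

record motion =
  posx :: "real \<Rightarrow> real"
  posy :: "real \<Rightarrow> real"
  angle :: "real \<Rightarrow> real"
  vel1 :: "real \<Rightarrow> real"
  vel2 :: "real \<Rightarrow> real"
  omg :: "real \<Rightarrow> real"

definition a1 :: "body_system \<Rightarrow> real" where
  "a1 P = mass_b P + mass_p P + mass_r P + add1 P"

definition a2 :: "body_system \<Rightarrow> real" where
  "a2 P = mass_b P + mass_p P + mass_r P + add2 P"

definition f_coeff :: "body_system \<Rightarrow> controls \<Rightarrow> real \<Rightarrow> real" where
  "f_coeff P c t = - mass_p P * eta c t"

definition g_coeff :: "body_system \<Rightarrow> controls \<Rightarrow> real \<Rightarrow> real" where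
  "g_coeff P c t = mass_p P * xi c t"

definition b_coeff :: "body_system \<Rightarrow> controls \<Rightarrow> real \<Rightarrow> real" where
  "b_coeff P c t =
     mass_b P * ((xi_b P)\<^sup>2 + (eta_b P)\<^sup>2) + inertia_b P
     + mass_p P * ((xi c t)\<^sup>2 + (eta c t)\<^sup>2)
     + mass_r P * ((xi_r P)\<^sup>2 + (eta_r P)\<^sup>2) + inertia_r P + add6 P"

definition p_x :: "body_system \<Rightarrow> controls \<Rightarrow> motion \<Rightarrow> real \<Rightarrow> real" where
  "p_x P c q t =
     (a1 P * vel1 q t + f_coeff P c t * omg q t + mass_p P * dxi c t - chi P) * cos (angle q t)
     - (a2 P * vel2 q t + g_coeff P c t * omg q t + mass_p P * deta c t - zet P) * sin (angle q t)
     + lam P * posy q t"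

definition p_y :: "body_system \<Rightarrow> controls \<Rightarrow> motion \<Rightarrow> real \<Rightarrow> real" where
  "p_y P c q t =
     (a1 P * vel1 q t + f_coeff P c t * omg q t + mass_p P * dxi c t - chi P) * sin (angle q t)
     + (a2 P * vel2 q t + g_coeff P c t * omg q t + mass_p P * deta c t - zet P) * cos (angle q t)
     - lam P * posx q t"

definition K_int :: "body_system \<Rightarrow> controls \<Rightarrow> motion \<Rightarrow> real \<Rightarrow> real" where
  "K_int P c q t =
     f_coeff P c t * vel1 q t + g_coeff P c t * vel2 q t + b_coeff P c t * omg q t
     + mass_p P * (xi c t * deta c t - dxi c t * eta c t) + inertia_r P * rotor c t
     + lam P / 2 * ((posx q t)\<^sup>2 + (posy q t)\<^sup>2)
     + posx q t * p_y P c q t - posy q t * p_x P c q t"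

text \<open>
  Controls and motions are considered on the half-line \<open>t \<ge> T\<close>; derivatives at \<open>T\<close> itself
  are one-sided. The controls need not join smoothly to those used before \<open>T\<close>.
\<close>

definition bounded_controls :: "body_system \<Rightarrow> real \<Rightarrow> controls \<Rightarrow> bool" where
  "bounded_controls P T c \<longleftrightarrow>
     (\<forall>t\<ge>T. (xi c has_real_derivative dxi c t) (at t within {T..}) \<and>
            (eta c has_real_derivative deta c t) (at t within {T..}) \<and>
            (xi c t, eta c t) \<in> region P) \<and>
     bounded (dxi c ` {T..}) \<and> bounded (deta c ` {T..}) \<and> bounded (rotor c ` {T..})"

text \<open>
  The kinematic relations, together with the integrals on the level set of a system that started
  from rest at \<open>x = y = \<alpha> = 0\<close>. On this level set the integrals determine
  \<open>(v\<^sub>1, v\<^sub>2, \<omega>)\<close>, so they take the place of the dynamic equations.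
\<close>

definition is_motion :: "body_system \<Rightarrow> real \<Rightarrow> controls \<Rightarrow> motion \<Rightarrow> bool" where
  "is_motion P T c q \<longleftrightarrow>
     (\<forall>t\<ge>T.
        (posx q has_real_derivative
           vel1 q t * cos (angle q t) - vel2 q t * sin (angle q t)) (at t within {T..}) \<and>
        (posy q has_real_derivative
           vel1 q t * sin (angle q t) + vel2 q t * cos (angle q t)) (at t within {T..}) \<and>
        (angle q has_real_derivative omg q t) (at t within {T..}) \<and>
        p_x P c q t = - chi P \<and> p_y P c q t = - zet P \<and> K_int P c q t = 0)"

definition partial_stabilization ::
  "body_system \<Rightarrow> real \<Rightarrow> real \<Rightarrow> real \<Rightarrow> real \<Rightarrow> controls \<Rightarrow> motion \<Rightarrow> bool" where
  "partial_stabilization P T x y \<alpha> c q \<longleftrightarrow>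
     bounded_controls P T c \<and> is_motion P T c q \<and>
     posx q T = x \<and> posy q T = y \<and> angle q T = \<alpha> \<and>
     (\<forall>t\<ge>T. (posx q has_real_derivative 0) (at t within {T..}) \<and>
            (posy q has_real_derivative 0) (at t within {T..}) \<and>
            omg q t \<noteq> 0)"

text \<open>
  The polar angle \<open>\<gamma>\<close> is constant and \<open>\<rho>\<close> is the distance of the mass from the origin, hence
  nonnegative.
\<close>

definition rectilinear :: "real \<Rightarrow> controls \<Rightarrow> bool" where
  "rectilinear T c \<longleftrightarrow>
     (\<exists>\<gamma>. \<forall>t\<ge>T. let \<rho> = sqrt ((xi c t)\<^sup>2 + (eta c t)\<^sup>2)
                in xi c t = \<rho> * cos \<gamma> \<and> eta c t = \<rho> * sin \<gamma>)"

definition line_stabilizable :: "body_system \<Rightarrow> real \<Rightarrow> real \<Rightarrow> real \<Rightarrow> real \<Rightarrow> bool" where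
  "line_stabilizable P T x y \<alpha> \<longleftrightarrow>
     (\<exists>c q. partial_stabilization P T x y \<alpha> c q \<and> rectilinear T c)"

end

theory Submission
  imports Defs
begin

text \<open>
  Suppose \<open>r > \<sigma>\<close>. In polar coordinates the first two integrals read
  \<open>m \<rho>' = r cos \<theta> + A\<close> and \<open>m \<rho> \<theta>' = B - r sin \<theta>\<close> with \<open>A\<^sup>2 + B\<^sup>2 = \<sigma>\<^sup>2\<close>, where \<open>\<theta>\<close> differs
  from \<open>\<alpha>\<close> by a constant. As \<open>\<theta>' \<noteq> 0\<close>, the angle is strictly monotone, and up to a reflection
  it increases. Then \<open>r sin \<theta> \<le> B < r\<close>, so \<open>\<theta>\<close> never crosses \<open>\<pi>/2\<close> modulo \<open>2\<pi>\<close>; it is bounded and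
  converges to some \<open>l\<close>. Boundedness of \<open>\<rho>\<close> and \<open>\<theta>\<close> forces both limiting right-hand sides to
  vanish: \<open>r cos l = -A\<close> and \<open>r sin l = B\<close>, hence \<open>r = \<sigma>\<close>, a contradiction.
\<close>

section \<open>Calculus on a half-line with one-sided derivatives at its end point\<close>

lemma mvt_atLeast:
  fixes f f' :: "real \<Rightarrow> real"
  assumes f: "\<And>t. t \<ge> T \<Longrightarrow> (f has_real_derivative f' t) (at t within {T..})"
    and "T \<le> a" "a < b"
  shows "\<exists>z\<in>{a<..<b}. f b - f a = f' z * (b - a)"
proof (rule mvt_simple[OF \<open>a < b\<close>])
  fix x assume "a \<le> x" "x \<le> b"
  then have "(f has_real_derivative f' x) (at x within {a..b})"
    using assms by (intro DERIV_subset[OF f]) auto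
  then show "(f has_derivative (*) (f' x)) (at x within {a..b})"
    by (simp add: has_field_derivative_def)
qed

text \<open>This covers the end point \<open>t = T\<close> as well: \<open>at t within {T..}\<close>
  is a nontrivial filter because it lies above the right-hand filter
  \<open>at t within {t<..}\<close>.\<close>

lemma has_real_derivative_unique_atLeast:
  fixes f :: "real \<Rightarrow> real"
  assumes "(f has_real_derivative d) (at t within {T..})"
    and "(f has_real_derivative e) (at t within {T..})" and "t \<ge> T"
  shows "d = e"
proof (rule vector_derivative_unique_within)
  have "at t within {t<..} \<le> at t within {T..}"
    using assms(3) by (intro at_le) auto
  then show "at t within {T..} \<noteq> bot"
    using trivial_limit_at_right_real[of t] by (metis bot.extremum_uniqueI)
qed (use assms in \<open>simp_all add: has_real_derivative_iff_has_vector_derivative\<close>)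

lemma derivative_bounded_below_imp_unbounded:
  fixes f f' :: "real \<Rightarrow> real"
  assumes f: "\<And>t. t \<ge> T \<Longrightarrow> (f has_real_derivative f' t) (at t within {T..})"
    and "eventually (\<lambda>t. f' t \<ge> c) at_top" and "c > 0"
  shows "\<exists>t\<ge>T. f t > M"
proof -
  obtain N where N: "\<And>t. t \<ge> N \<Longrightarrow> f' t \<ge> c"
    using assms(2) by (auto simp: eventually_at_top_linorder)
  define a where "a = max N T"
  define b where "b = a + (\<bar>M - f a\<bar> + 1) / c"
  have "a < b" unfolding b_def using \<open>c > 0\<close> by simp
  obtain z where z: "z \<in> {a<..<b}" "f b - f a = f' z * (b - a)"
    using mvt_atLeast[OF f _ \<open>a < b\<close>] by (auto simp: a_def)
  have "c * (b - a) \<le> f' z * (b - a)"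
    using N[of z] z(1) \<open>a < b\<close> by (intro mult_right_mono) (auto simp: a_def)
  moreover have "c * (b - a) = \<bar>M - f a\<bar> + 1"
    using \<open>c > 0\<close> by (simp add: b_def)
  ultimately have "f b > M" using z(2) by linarith
  then show ?thesis using \<open>a < b\<close> by (intro exI[of _ b]) (auto simp: a_def)
qed

text \<open>A form of Darboux's theorem, where \<open>f'\<close> may be discontinuous. The mean
  value theorem makes \<open>f\<close> injective, a continuous injection on an interval is strictly
  monotone, and a derivative of the wrong sign at a single point would contradict this just to the
  right of that point.\<close>

lemma nonzero_derivative_constant_sign:
  fixes f f' :: "real \<Rightarrow> real"
  assumes f: "\<And>t. t \<ge> T \<Longrightarrow> (f has_real_derivative f' t) (at t within {T..})"
    and nz: "\<And>t. t \<ge> T \<Longrightarrow> f' t \<noteq> 0"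
  shows "(\<forall>t\<ge>T. f' t > 0) \<or> (\<forall>t\<ge>T. f' t < 0)"
proof -
  have neq: "f a \<noteq> f b" if "T \<le> a" "a < b" for a b
    using mvt_atLeast[of T f f', OF f that] nz that by force
  then have "inj_on f {T..}"
    by (metis atLeast_iff inj_onI linorder_neqE_linordered_idom)
  moreover have "continuous_on {T..} f"
    using f by (intro DERIV_continuous_on) auto
  ultimately have "strict_mono_on {T..} f \<or> strict_antimono_on {T..} f"
    using injective_eq_monotone_map[of "{T..}" f] by (simp add: is_interval_ci)
  then show ?thesis
  proof
    assume mono: "strict_mono_on {T..} f"
    have "f' t > 0" if "t \<ge> T" for t
    proof (rule ccontr)
      assume "\<not> f' t > 0"
      then have "f' t < 0" using nz[OF that] by simp
      from has_real_derivative_neg_dec_right[OF f[OF that] this]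
      obtain d where "d > 0" "\<And>h. h > 0 \<Longrightarrow> t + h \<in> {T..} \<Longrightarrow> h < d \<Longrightarrow> f t > f (t + h)"
        by blast
      from this(2)[of "d / 2"] \<open>d > 0\<close> that have "f t > f (t + d / 2)" by simp
      moreover have "f t < f (t + d / 2)"
        using mono that \<open>d > 0\<close> by (auto intro: strict_mono_onD)
      ultimately show False by simp
    qed
    then show ?thesis by blast
  next
    assume anti: "strict_antimono_on {T..} f"
    have "f' t < 0" if "t \<ge> T" for t
    proof (rule ccontr)
      assume "\<not> f' t < 0"
      then have "f' t > 0" using nz[OF that] by simp
      from has_real_derivative_pos_inc_right[OF f[OF that] this]
      obtain d where "d > 0" "\<And>h. h > 0 \<Longrightarrow> t + h \<in> {T..} \<Longrightarrow> h < d \<Longrightarrow> f t < f (t + h)"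
        by blast
      from this(2)[of "d / 2"] \<open>d > 0\<close> that have "f t < f (t + d / 2)" by simp
      moreover have "f t > f (t + d / 2)"
        using monotone_onD[OF anti, of t "t + d / 2"] that \<open>d > 0\<close> by auto
      ultimately show False by simp
    qed
    then show ?thesis by blast
  qed
qed

lemma mono_bounded_tendsto_at_top:
  fixes f :: "real \<Rightarrow> real"
  assumes mono: "\<And>s t. T \<le> s \<Longrightarrow> s \<le> t \<Longrightarrow> f s \<le> f t"
    and bd: "\<And>t. t \<ge> T \<Longrightarrow> f t \<le> M"
  shows "\<exists>l. (f \<longlongrightarrow> l) at_top"
proof -
  have bdd: "bdd_above (f ` {T..})" using bd by (auto intro!: bdd_aboveI[of _ M])
  have "(f \<longlongrightarrow> Sup (f ` {T..})) at_top"
  proof (rule increasing_tendsto)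
    show "eventually (\<lambda>t. f t \<le> Sup (f ` {T..})) at_top"
      using eventually_ge_at_top[of T]
      by eventually_elim (auto intro!: cSup_upper bdd)
    fix x assume "x < Sup (f ` {T..})"
    then obtain s where "s \<ge> T" "x < f s"
      using less_cSup_iff[OF _ bdd] by auto
    then have "x < f t" if "t \<ge> s" for t
      using mono[OF \<open>s \<ge> T\<close> that] by simp
    then show "eventually (\<lambda>t. x < f t) at_top"
      unfolding eventually_at_top_linorder by blast
  qed
  then show ?thesis ..
qed

section \<open>Nonexistence of bounded polar motions\<close>

lemma no_bounded_increasing_polar_motion:
  fixes \<rho> \<theta> w :: "real \<Rightarrow> real" and r m A B R T :: real
  assumes "m > 0" "r \<ge> 0" and AB: "A\<^sup>2 + B\<^sup>2 < r\<^sup>2"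
    and \<rho>: "\<And>t. t \<ge> T \<Longrightarrow> (\<rho> has_real_derivative (r * cos (\<theta> t) + A) / m) (at t within {T..})"
    and \<theta>: "\<And>t. t \<ge> T \<Longrightarrow> (\<theta> has_real_derivative w t) (at t within {T..})"
    and eq: "\<And>t. t \<ge> T \<Longrightarrow> m * \<rho> t * w t = B - r * sin (\<theta> t)"
    and w: "\<And>t. t \<ge> T \<Longrightarrow> w t > 0"
    and \<rho>0: "\<And>t. t \<ge> T \<Longrightarrow> \<rho> t \<ge> 0" and R: "\<And>t. t \<ge> T \<Longrightarrow> \<rho> t \<le> R"
  shows False
proof -
  have "B < r"
    using AB \<open>r \<ge> 0\<close> by (smt (verit) power2_le_imp_le zero_le_power2 power_mono)
  \<comment> \<open>The sign comes from \<open>\<rho> t \<ge> 0\<close>, that is, from the mass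
    staying on one ray from the origin.\<close>
  have ge0: "B - r * sin (\<theta> t) \<ge> 0" if "t \<ge> T" for t
    unfolding eq[OF that, symmetric] using \<open>m > 0\<close> w[OF that] \<rho>0[OF that] by simp
  \<comment> \<open>The barrier \<open>M\<close> is an angle congruent to \<open>pi / 2\<close> that
    lies above the initial angle. Reaching it would turn \<open>ge0\<close> into
    \<open>B - r \<ge> 0\<close>.\<close>
  obtain k :: nat where k: "(\<theta> T - pi / 2) / (2 * pi) < real k"
    using reals_Archimedean2 by blast
  define M where "M = pi / 2 + 2 * pi * real k"
  have "\<theta> T < M" using k by (simp add: M_def field_simps)
  have sinM: "sin M = 1"
  proof -
    have "cos (2 * pi * real k) = 1" using cos_2npi[of k] by (simp add: ac_simps)
    then show ?thesis by (simp add: M_def sin_add)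
  qed
  have \<theta>M: "\<theta> t \<le> M" if t: "t \<ge> T" for t
  proof (rule ccontr)
    assume "\<not> \<theta> t \<le> M"
    moreover have "continuous_on {T..t} \<theta>"
      by (rule DERIV_continuous_on, rule DERIV_subset[OF \<theta>]) auto
    ultimately obtain s where "T \<le> s" "\<theta> s = M"
      using IVT'[of \<theta> T M t] \<open>\<theta> T < M\<close> t by force
    with ge0[of s] sinM \<open>B < r\<close> show False by simp
  qed
  have \<theta>mono: "\<theta> s \<le> \<theta> t" if "T \<le> s" "s \<le> t" for s t
  proof (cases "s = t")
    case False
    with that have "s < t" by simp
    obtain z where "z \<in> {s<..<t}" "\<theta> t - \<theta> s = w z * (t - s)"
      using mvt_atLeast[of T \<theta> w, OF \<theta> \<open>T \<le> s\<close> \<open>s < t\<close>] by blast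
    moreover have "w z * (t - s) \<ge> 0"
      using w[of z] calculation(1) that by auto
    ultimately show ?thesis by simp
  qed simp
  obtain l where l: "(\<theta> \<longlongrightarrow> l) at_top"
    using mono_bounded_tendsto_at_top[of T \<theta> M, OF \<theta>mono \<theta>M] by blast
  define a where "a = (r * cos l + A) / m"
  have lima: "((\<lambda>t. (r * cos (\<theta> t) + A) / m) \<longlongrightarrow> a) at_top"
    unfolding a_def using \<open>m > 0\<close> by (intro tendsto_intros l) auto
  \<comment> \<open>A nonzero limit \<open>a\<close> of the radial velocity would eventually keep it
    beyond \<open>a / 2\<close>, driving \<open>\<rho>\<close> above \<open>R\<close> if
    \<open>a > 0\<close> and below \<open>0\<close> if \<open>a < 0\<close>.\<close>
  have "\<not> a > 0"
  proof
    assume "a > 0"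
    then have "eventually (\<lambda>t. (r * cos (\<theta> t) + A) / m > a / 2) at_top"
      by (intro order_tendstoD(1)[OF lima]) simp
    then have "eventually (\<lambda>t. (r * cos (\<theta> t) + A) / m \<ge> a / 2) at_top"
      by (rule eventually_mono) simp
    from derivative_bounded_below_imp_unbounded[OF \<rho> this, of R] \<open>a > 0\<close> R show False
      by force
  qed
  moreover have "\<not> a < 0"
  proof
    assume "a < 0"
    then have "eventually (\<lambda>t. (r * cos (\<theta> t) + A) / m < a / 2) at_top"
      by (intro order_tendstoD(2)[OF lima]) simp
    then have "eventually (\<lambda>t. - ((r * cos (\<theta> t) + A) / m) \<ge> - (a / 2)) at_top"
      by (rule eventually_mono) simp
    from derivative_bounded_below_imp_unbounded[OF DERIV_minus[OF \<rho>] this, of 0] \<open>a < 0\<close> \<rho>0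
    show False by force
  qed
  ultimately have A: "r * cos l = - A" using \<open>m > 0\<close> by (simp add: a_def field_simps)
  define L where "L = B - r * sin l"
  have limL: "((\<lambda>t. B - r * sin (\<theta> t)) \<longlongrightarrow> L) at_top"
    unfolding L_def by (intro tendsto_intros l)
  have "L \<ge> 0"
    by (rule tendsto_lowerbound[OF limL])
       (use ge0 in \<open>auto simp: eventually_at_top_linorder\<close>)
  have "\<not> L > 0"
  proof
    assume "L > 0"
    \<comment> \<open>\<open>S\<close> is a bound for \<open>\<rho>\<close> that is safe to divide
      by. Since \<open>m * \<rho> t * w t\<close> eventually exceeds \<open>L / 2\<close>, the
      angular velocity is at least \<open>L / (2 * m * S)\<close>, so \<open>\<theta>\<close> would
      pass \<open>M\<close>.\<close>
    define S where "S = max R 1"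
    have "eventually (\<lambda>t. B - r * sin (\<theta> t) > L / 2) at_top"
      using \<open>L > 0\<close> by (intro order_tendstoD(1)[OF limL]) simp
    then have "eventually (\<lambda>t. w t \<ge> L / (2 * m * S)) at_top"
      using eventually_ge_at_top[of T]
    proof eventually_elim
      case (elim t)
      have "\<rho> t \<le> S" using R[OF elim(2)] by (simp add: S_def)
      then have "m * \<rho> t * w t \<le> m * S * w t"
        using w[OF elim(2)] \<open>m > 0\<close> by (intro mult_right_mono mult_left_mono) auto
      with elim eq[OF elim(2)] have "L / 2 \<le> m * S * w t" by simp
      moreover have "S > 0" by (simp add: S_def)
      ultimately show ?case using \<open>m > 0\<close> by (simp add: field_simps)
    qed
    moreover have "L / (2 * m * S) > 0" using \<open>L > 0\<close> \<open>m > 0\<close> by (simp add: S_def)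
    ultimately show False
      using derivative_bounded_below_imp_unbounded[of T \<theta> w, OF \<theta>, of _ M] \<theta>M by force
  qed
  with \<open>L \<ge> 0\<close> have "r * sin l = B" by (simp add: L_def)
  with A have "A\<^sup>2 + B\<^sup>2 = (r * cos l)\<^sup>2 + (r * sin l)\<^sup>2" by simp
  also have "\<dots> = r\<^sup>2 * ((sin l)\<^sup>2 + (cos l)\<^sup>2)"
    by algebra
  finally show False using AB by simp
qed

text \<open>A decreasing angle is reduced to an increasing one by the reflection that negates
  \<open>\<theta>\<close>, \<open>w\<close> and \<open>B\<close>: cosine is even and sine odd, so
  \<open>\<rho>\<close>, \<open>r\<close> and \<open>A\<close> stay the same.\<close>

lemma no_bounded_polar_motion:
  fixes \<rho> \<theta> w :: "real \<Rightarrow> real" and r m A B R T :: real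
  assumes "m > 0" "r \<ge> 0" and AB: "A\<^sup>2 + B\<^sup>2 < r\<^sup>2"
    and \<rho>: "\<And>t. t \<ge> T \<Longrightarrow> (\<rho> has_real_derivative (r * cos (\<theta> t) + A) / m) (at t within {T..})"
    and \<theta>: "\<And>t. t \<ge> T \<Longrightarrow> (\<theta> has_real_derivative w t) (at t within {T..})"
    and eq: "\<And>t. t \<ge> T \<Longrightarrow> m * \<rho> t * w t = B - r * sin (\<theta> t)"
    and w: "\<And>t. t \<ge> T \<Longrightarrow> w t \<noteq> 0"
    and \<rho>0: "\<And>t. t \<ge> T \<Longrightarrow> \<rho> t \<ge> 0" and R: "\<And>t. t \<ge> T \<Longrightarrow> \<rho> t \<le> R"
  shows False
  using nonzero_derivative_constant_sign[of T \<theta> w, OF \<theta> w]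
proof
  assume "\<forall>t\<ge>T. w t > 0"
  then show False
    using no_bounded_increasing_polar_motion[of m r A B T \<rho> \<theta> w R] assms by blast
next
  assume neg: "\<forall>t\<ge>T. w t < 0"
  show False
  proof (rule no_bounded_increasing_polar_motion[of m r A "- B" T \<rho> "\<lambda>t. - \<theta> t" "\<lambda>t. - w t" R])
    show "m * \<rho> t * - w t = - B - r * sin (- \<theta> t)" if "t \<ge> T" for t
      using eq[OF that] by simp
  qed (use assms neg in \<open>auto intro: DERIV_minus\<close>)
qed

section \<open>Reduction of the stabilized motion to the polar equations\<close>

lemma unrotate:
  fixes u v :: real
  assumes "u * cos a - v * sin a = X" "u * sin a + v * cos a = Y"
  shows "u = X * cos a + Y * sin a" "v = Y * cos a - X * sin a"
proof -
  have "X * cos a + Y * sin a = u * ((sin a)\<^sup>2 + (cos a)\<^sup>2)"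
    "Y * cos a - X * sin a = v * ((sin a)\<^sup>2 + (cos a)\<^sup>2)"
    unfolding assms[symmetric] by algebra+
  then show "u = X * cos a + Y * sin a" "v = Y * cos a - X * sin a" by simp_all
qed

theorem proposition4p3:
  fixes P :: body_system and T x y \<alpha> :: real
  assumes "valid_system P"
    and "lam P \<noteq> 0"
    and "line_stabilizable P T x y \<alpha>"
  shows "sqrt ((chi P + lam P * y)\<^sup>2 + (lam P * x - zet P)\<^sup>2)
           \<le> sqrt ((chi P)\<^sup>2 + (zet P)\<^sup>2)"
proof (rule ccontr)
  assume neg: "\<not> ?thesis"
  obtain c q where st: "partial_stabilization P T x y \<alpha> c q" and "rectilinear T c"
    using assms(3) by (auto simp: line_stabilizable_def)
  then obtain \<gamma> where \<gamma>: "\<And>t. t \<ge> T \<Longrightarrow> xi c t = sqrt ((xi c t)\<^sup>2 + (eta c t)\<^sup>2) * cos \<gamma>"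
      "\<And>t. t \<ge> T \<Longrightarrow> eta c t = sqrt ((xi c t)\<^sup>2 + (eta c t)\<^sup>2) * sin \<gamma>"
    unfolding rectilinear_def Let_def by blast
  define m where "m = mass_p P"
  have "m > 0" using assms(1) by (simp add: valid_system_def m_def)
  define X where "X = - chi P - lam P * y"
  define Y where "Y = lam P * x - zet P"
  define r where "r = sqrt (X\<^sup>2 + Y\<^sup>2)"
  have "r \<ge> 0" by (simp add: r_def)
  have r2: "r\<^sup>2 = X\<^sup>2 + Y\<^sup>2" by (simp add: r_def)
  obtain \<phi> where \<phi>: "X = r * cos \<phi>" "Y = r * sin \<phi>"
  proof -
    have "X = Re (Complex X Y)" "Y = Im (Complex X Y)" by simp_all
    then have "X = r * cos (Arg (Complex X Y))" "Y = r * sin (Arg (Complex X Y))"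
      using rcis_cmod_Arg[of "Complex X Y"] by (metis Re_rcis Im_rcis r_def complex_norm)+
    then show ?thesis by (rule that)
  qed
  have "(chi P)\<^sup>2 + (zet P)\<^sup>2 < (chi P + lam P * y)\<^sup>2 + Y\<^sup>2"
    using neg by (simp add: not_le Y_def)
  also have "(chi P + lam P * y)\<^sup>2 = X\<^sup>2"
    by (simp add: X_def power2_eq_square algebra_simps)
  finally have less: "(chi P)\<^sup>2 + (zet P)\<^sup>2 < r\<^sup>2" by (simp add: r2)

  have d\<xi>: "(xi c has_real_derivative dxi c t) (at t within {T..})"
    and d\<eta>: "(eta c has_real_derivative deta c t) (at t within {T..})"
    and reg: "(xi c t, eta c t) \<in> region P" if "t \<ge> T" for t
    using st that by (auto simp: partial_stabilization_def bounded_controls_def)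
  have dx: "(posx q has_real_derivative 0) (at t within {T..})"
    and dy: "(posy q has_real_derivative 0) (at t within {T..})"
    and d\<alpha>: "(angle q has_real_derivative omg q t) (at t within {T..})"
    and \<omega>: "omg q t \<noteq> 0" if "t \<ge> T" for t
    using st that by (auto simp: partial_stabilization_def is_motion_def)
  have pos: "posx q t = x" "posy q t = y" if "t \<ge> T" for t
  proof -
    have "\<exists>k. \<forall>t\<in>{T..}. posx q t = k" "\<exists>k. \<forall>t\<in>{T..}. posy q t = k"
      using dx dy by (intro has_field_derivative_zero_constant; simp)+
    then show "posx q t = x" "posy q t = y"
      using st that unfolding partial_stabilization_def by (metis atLeast_iff order_refl)+
  qed
  \<comment> \<open>The kinematic relations and the stabilization give two derivatives of the same
    position, which must agree; a rotation of the velocity that vanishes has vanishing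
    argument.\<close>
  have vel: "vel1 q t = 0" "vel2 q t = 0" if "t \<ge> T" for t
  proof -
    have "vel1 q t * cos (angle q t) - vel2 q t * sin (angle q t) = 0"
      "vel1 q t * sin (angle q t) + vel2 q t * cos (angle q t) = 0"
      using st that dx[OF that] dy[OF that]
      unfolding partial_stabilization_def is_motion_def
      by (meson has_real_derivative_unique_atLeast)+
    from unrotate[OF this] show "vel1 q t = 0" "vel2 q t = 0" by simp_all
  qed
  define \<rho> where "\<rho> t = sqrt ((xi c t)\<^sup>2 + (eta c t)\<^sup>2)" for t
  \<comment> \<open>In the fixed frame the mass lies in direction
    \<open>angle q t + \<gamma>\<close>, and \<open>\<theta>\<close> measures this direction from
    the constant vector \<open>(X, Y)\<close>. \<open>A\<close> and \<open>B\<close> are the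
    components of \<open>(chi P, zet P)\<close> along the line of motion and along its
    normal.\<close>
  define \<theta> where "\<theta> t = angle q t + \<gamma> - \<phi>" for t
  define A where "A = chi P * cos \<gamma> + zet P * sin \<gamma>"
  define B where "B = zet P * cos \<gamma> - chi P * sin \<gamma>"
  have "A\<^sup>2 + B\<^sup>2 = ((chi P)\<^sup>2 + (zet P)\<^sup>2) * ((sin \<gamma>)\<^sup>2 + (cos \<gamma>)\<^sup>2)"
    unfolding A_def B_def by algebra
  then have AB: "A\<^sup>2 + B\<^sup>2 < r\<^sup>2" using less by simp
  have \<xi>: "xi c t = \<rho> t * cos \<gamma>" and \<eta>: "eta c t = \<rho> t * sin \<gamma>" if "t \<ge> T" for t
    using \<gamma>[OF that] by (simp_all add: \<rho>_def)
  \<comment> \<open>On the ray the distance is a linear function of the coordinates, hence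
    differentiable even where the mass is at the origin and the square root is singular.\<close>
  have \<rho>_eq: "\<rho> t = xi c t * cos \<gamma> + eta c t * sin \<gamma>" if "t \<ge> T" for t
    using \<xi>[OF that] \<eta>[OF that] sin_cos_squared_add[of \<gamma>] by algebra
  \<comment> \<open>The distance to the line is identically zero, so the velocity has no component
    normal to it.\<close>
  have normal: "deta c t * cos \<gamma> - dxi c t * sin \<gamma> = 0" if "t \<ge> T" for t
  proof (rule has_real_derivative_unique_atLeast[OF _ _ that])
    show "((\<lambda>s. eta c s * cos \<gamma> - xi c s * sin \<gamma>) has_real_derivative
            deta c t * cos \<gamma> - dxi c t * sin \<gamma>) (at t within {T..})"
      by (auto intro!: derivative_eq_intros d\<xi> d\<eta> that)
    show "((\<lambda>s. eta c s * cos \<gamma> - xi c s * sin \<gamma>) has_real_derivative 0) (at t within {T..})"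
      by (rule has_field_derivative_transform_within[of "\<lambda>_. 0" _ _ _ 1])
         (use that in \<open>auto simp: \<xi> \<eta>\<close>)
  qed
  have momentum: "m * dxi c t - m * eta c t * omg q t
        = X * cos (angle q t) + Y * sin (angle q t) + chi P"
    "m * deta c t + m * xi c t * omg q t
        = Y * cos (angle q t) - X * sin (angle q t) + zet P" if "t \<ge> T" for t
  proof -
    define U where "U = m * dxi c t - m * eta c t * omg q t - chi P"
    define V where "V = m * deta c t + m * xi c t * omg q t - zet P"
    have "p_x P c q t = - chi P" "p_y P c q t = - zet P"
      using st that by (auto simp: partial_stabilization_def is_motion_def)
    then have "U * cos (angle q t) - V * sin (angle q t) = X"
      "U * sin (angle q t) + V * cos (angle q t) = Y"
      by (simp_all add: p_x_def p_y_def f_coeff_def g_coeff_def vel pos that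
            U_def V_def X_def Y_def m_def algebra_simps)
    from unrotate[OF this]
    show "m * dxi c t - m * eta c t * omg q t
        = X * cos (angle q t) + Y * sin (angle q t) + chi P"
      "m * deta c t + m * xi c t * omg q t
        = Y * cos (angle q t) - X * sin (angle q t) + zet P"
      by (simp_all add: U_def V_def)
  qed
  \<comment> \<open>These are the component of \<open>(X, Y)\<close> along the line of motion and
    the negative of its normal component.\<close>
  have \<theta>_eq: "r * cos (\<theta> t) = (X * cos (angle q t) + Y * sin (angle q t)) * cos \<gamma>
        + (Y * cos (angle q t) - X * sin (angle q t)) * sin \<gamma>"
    "r * sin (\<theta> t) = (X * cos (angle q t) + Y * sin (angle q t)) * sin \<gamma>
        - (Y * cos (angle q t) - X * sin (angle q t)) * cos \<gamma>" for t
    unfolding \<theta>_def \<phi> by (simp_all add: cos_diff sin_diff cos_add sin_add algebra_simps)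
  obtain R where R: "\<And>z. z \<in> region P \<Longrightarrow> norm z \<le> R"
    using assms(1) by (auto simp: valid_system_def bounded_iff)
  show False
  proof (rule no_bounded_polar_motion[OF \<open>m > 0\<close> \<open>r \<ge> 0\<close> AB, of T \<rho> \<theta> "omg q" R])
    fix t assume t: "t \<ge> T"
    have "((\<lambda>s. xi c s * cos \<gamma> + eta c s * sin \<gamma>) has_real_derivative
            dxi c t * cos \<gamma> + deta c t * sin \<gamma>) (at t within {T..})"
      by (auto intro!: derivative_eq_intros d\<xi> d\<eta> t)
    then have "(\<rho> has_real_derivative dxi c t * cos \<gamma> + deta c t * sin \<gamma>) (at t within {T..})"
      by (rule has_field_derivative_transform_within[of _ _ _ _ 1]) (use t in \<open>auto simp: \<rho>_eq\<close>)
    also have "dxi c t * cos \<gamma> + deta c t * sin \<gamma> = (r * cos (\<theta> t) + A) / m"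
    proof -
      \<comment> \<open>Projection of \<open>momentum\<close> onto the line; the terms with
        \<open>omg q t\<close> cancel because the position is parallel to it.\<close>
      have "m * (dxi c t * cos \<gamma> + deta c t * sin \<gamma>) = r * cos (\<theta> t) + A"
        unfolding \<theta>_eq A_def using momentum[OF t] \<xi>[OF t] \<eta>[OF t] by algebra
      then show ?thesis using \<open>m > 0\<close> by (simp add: field_simps)
    qed
    finally show "(\<rho> has_real_derivative (r * cos (\<theta> t) + A) / m) (at t within {T..})" .
    show "(\<theta> has_real_derivative omg q t) (at t within {T..})"
      unfolding \<theta>_def by (auto intro!: derivative_eq_intros d\<alpha> t)
    \<comment> \<open>Projection of \<open>momentum\<close> onto the normal, where only the
      rotational term survives by \<open>normal\<close>.\<close>
    show "m * \<rho> t * omg q t = B - r * sin (\<theta> t)"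
      unfolding \<theta>_eq B_def using momentum[OF t] \<rho>_eq[OF t] normal[OF t] by algebra
    show "omg q t \<noteq> 0" by (rule \<omega>[OF t])
    show "\<rho> t \<ge> 0" by (simp add: \<rho>_def)
    show "\<rho> t \<le> R" using R[OF reg[OF t]] by (simp add: \<rho>_def norm_Pair)
  qed
qed

end
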